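(* For all positive integers $n,f,L$ with $L\ge 2$, there is an $n$-vertex graph $G$ such that any $(L,f)$-replacement path covering for $G$ has covering value at least $$\min\Big\{\sum_{i=0}^{f-1}\binom{L-2}{i},\ n\Big\}.$$
   Context: Graphs may be directed and edge-weighted. For a graph $G=(V,E)$ and $F\subseteq E$, $G-F$ denotes $G$ with the edges of $F$ removed. An $(L,f)$-replacement path covering for $G$ is a family $\mathcal{G}$ of spanning subgraphs of $G$ together with, for every set $F\subseteq E$ with $|F|\le f$, a subfamily $\mathcal{G}_F\subseteq\mathcal{G}$ such that: (1) no subgraph in $\mathcal{G}_F$ contains an edge of $F$; (2) for all $s,t\in V$ such that there exists a shortest path from $s$ to $t$ in $G-F$ with at most $L$ edges, at least one subgraph in $\mathcal{G}_F$ also contains such a path. The covering value is $|\mathcal{G}|$. *)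

theory Defs imports Complex_Main begin

datatype 'a edge = Arc 'a 'a | Link "'a set"

record 'a wgraph =
  directed :: bool
  verts :: "'a set"
  edges :: "'a edge set"
  weight :: "'a edge \<Rightarrow> real"

definition edge_between :: "bool \<Rightarrow> 'a \<Rightarrow> 'a \<Rightarrow> 'a edge" where
  "edge_between d u v = (if d then Arc u v else Link {u, v})"

text \<open>Finite simple graphs, directed or undirected, with positive edge weights.
  Unweighted graphs are those of constant weight 1.\<close>

definition wf_graph :: "'a wgraph \<Rightarrow> bool" where
  "wf_graph G \<longleftrightarrow>
     finite (verts G) \<and>
     edges G \<subseteq> {edge_between (directed G) u v | u v. u \<in> verts G \<and> v \<in> verts G \<and> u \<noteq> v} \<and>
     (\<forall>e\<in>edges G. 0 < weight G e)"

definition remove_edges :: "'a wgraph \<Rightarrow> 'a edge set \<Rightarrow> 'a wgraph" where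
  "remove_edges G F = G\<lparr>edges := edges G - F\<rparr>"

definition spanning_subgraph :: "'a wgraph \<Rightarrow> 'a wgraph \<Rightarrow> bool" where
  "spanning_subgraph H G \<longleftrightarrow>
     directed H = directed G \<and> verts H = verts G \<and> edges H \<subseteq> edges G \<and> weight H = weight G"

text \<open>A path is given by its list of vertices, which in a simple graph determines its edges.\<close>

definition path_edges :: "'a wgraph \<Rightarrow> 'a list \<Rightarrow> 'a edge list" where
  "path_edges G p = map (\<lambda>(u, v). edge_between (directed G) u v) (zip p (tl p))"

definition is_path :: "'a wgraph \<Rightarrow> 'a \<Rightarrow> 'a list \<Rightarrow> 'a \<Rightarrow> bool" where
  "is_path G s p t \<longleftrightarrow>
     p \<noteq> [] \<and> hd p = s \<and> last p = t \<and> distinct p \<and>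
     set p \<subseteq> verts G \<and> set (path_edges G p) \<subseteq> edges G"

definition path_weight :: "'a wgraph \<Rightarrow> 'a list \<Rightarrow> real" where
  "path_weight G p = sum_list (map (weight G) (path_edges G p))"

definition is_shortest_path :: "'a wgraph \<Rightarrow> 'a \<Rightarrow> 'a list \<Rightarrow> 'a \<Rightarrow> bool" where
  "is_shortest_path G s p t \<longleftrightarrow>
     is_path G s p t \<and> (\<forall>q. is_path G s q t \<longrightarrow> path_weight G p \<le> path_weight G q)"

definition replacement_path_covering ::
  "nat \<Rightarrow> nat \<Rightarrow> 'a wgraph \<Rightarrow> 'a wgraph set \<Rightarrow> ('a edge set \<Rightarrow> 'a wgraph set) \<Rightarrow> bool" where
  "replacement_path_covering L f G \<G> sub \<longleftrightarrow>
     (\<forall>H\<in>\<G>. spanning_subgraph H G) \<and>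
     (\<forall>F. F \<subseteq> edges G \<and> card F \<le> f \<longrightarrow>
        sub F \<subseteq> \<G> \<and>
        (\<forall>H\<in>sub F. edges H \<inter> F = {}) \<and>
        (\<forall>s\<in>verts G. \<forall>t\<in>verts G.
           (\<exists>p. is_shortest_path (remove_edges G F) s p t \<and> length (path_edges G p) \<le> L) \<longrightarrow>
           (\<exists>H\<in>sub F. \<exists>p. is_shortest_path (remove_edges G F) s p t \<and>
              length (path_edges G p) \<le> L \<and> is_path H s p t)))"

end

theory Submission imports Defs "HOL-Library.Sublist" "HOL-Library.Countable" begin

text \<open>The graph is a directed binary tree: vertices are bit strings of length at most \<open>L - 2\<close> with
  at most \<open>f - 1\<close> ones, and \<open>b # x\<close> is the child of \<open>x\<close> reached by the bit \<open>b\<close>, so that the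
  ancestors of a vertex are its suffixes.  For a vertex \<open>x\<close> let \<open>F x\<close> consist of the arcs leaving
  \<open>x\<close> and, for every one-arc on the path from the root to \<open>x\<close>, the sibling zero-arc.  A vertex with
  \<open>f - 1\<close> ones has only a zero-child, hence \<open>F x\<close> has at most \<open>f\<close> elements.  For distinct \<open>x\<close>
  and \<open>y\<close>, one of the root paths to \<open>x\<close> and \<open>y\<close> meets the failure set of the other vertex,
  so no single subgraph can serve both; thus there are at least as many subgraphs as tree
  vertices.  Pruning leaves, or adding isolated vertices, adjusts the number of vertices to
  \<open>n\<close>.\<close>

section \<open>Bit strings ordered by suffixes\<close>

lemma suffix_eq_or_Cons:
  assumes "suffix x y"
  shows "x = y \<or> (\<exists>b. suffix (b # x) y)"
proof -
  from assms obtain u where u: "y = u @ x" by (auto simp: suffix_def)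
  show ?thesis
  proof (cases u rule: rev_cases)
    case Nil
    then show ?thesis using u by simp
  next
    case (snoc w b)
    then have "y = w @ (b # x)" using u by simp
    then show ?thesis by (auto simp: suffix_def)
  qed
qed

text \<open>Read from the right ends, that is from the root, two strings agree until one is
  exhausted or they take different bits at a common ancestor \<open>z\<close>. These are the cases
  needed to separate two tree vertices.\<close>

lemma suffix_compare:
  fixes x y :: "'b list"
  shows "x = y \<or> (\<exists>b. suffix (b # x) y) \<or> (\<exists>b. suffix (b # y) x) \<or>
    (\<exists>z a b. a \<noteq> b \<and> suffix (a # z) x \<and> suffix (b # z) y)"
proof (induction x)
  case Nil
  show ?case using suffix_eq_or_Cons[of "[]" y] by auto
next
  case (Cons a x)
  consider "x = y" | b where "suffix (b # x) y" | b where "suffix (b # y) x"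
    | z c d where "c \<noteq> d" "suffix (c # z) x" "suffix (d # z) y"
    using Cons.IH by blast
  then show ?case
  proof cases
    case 1
    then show ?thesis by auto
  next
    case 2
    show ?thesis
    proof (cases "a = b")
      case True
      then show ?thesis using suffix_eq_or_Cons[OF 2] by auto
    next
      case False
      then show ?thesis using 2 by blast
    qed
  next
    case 3
    then show ?thesis by (blast intro: suffix_ConsI)
  next
    case 4
    then show ?thesis by (blast intro: suffix_ConsI)
  qed
qed

lemma suffix_Cons_unique: "suffix (a # z) x \<Longrightarrow> suffix (b # z) x \<Longrightarrow> a = b"
  by (auto simp: suffix_def)

text \<open>Closure under taking the parent; a nonempty such set is a subtree containing the
  root.\<close>

definition suffix_closed :: "'b list set \<Rightarrow> bool" where
  "suffix_closed T \<longleftrightarrow> (\<forall>b x. b # x \<in> T \<longrightarrow> x \<in> T)"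

lemma suffix_closedD: "suffix_closed T \<Longrightarrow> suffix y x \<Longrightarrow> x \<in> T \<Longrightarrow> y \<in> T"
proof (induction x)
  case (Cons a x)
  then show ?case by (auto simp: suffix_closed_def suffix_Cons)
qed simp

text \<open>A longest string is a leaf, so deleting it keeps the set closed; leaves are deleted
  until \<open>m\<close> strings remain.\<close>

lemma suffix_closed_subset_card:
  assumes "finite U" "suffix_closed U" "m \<le> card U"
  shows "\<exists>T\<subseteq>U. suffix_closed T \<and> card T = m"
  using assms
proof (induction "card U - m" arbitrary: U)
  case 0
  then show ?case by auto
next
  case (Suc k)
  then have "U \<noteq> {}" by auto
  with Suc.prems(1) obtain x where x: "x \<in> U" "\<And>y. y \<in> U \<Longrightarrow> length y \<le> length x"
    using Max_in[of "length ` U"] Max_ge[of "length ` U"] by fastforce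
  have "suffix_closed (U - {x})"
    using Suc.prems(2) x(2) by (fastforce simp: suffix_closed_def)
  moreover have "card (U - {x}) = card U - 1" using x(1) Suc.prems(1) by simp
  ultimately have "\<exists>T\<subseteq>U - {x}. suffix_closed T \<and> card T = m"
    using Suc.hyps(2) Suc.prems(1) by (intro Suc.hyps(1)) auto
  then show ?case by blast
qed

section \<open>Counting bit strings by their number of ones\<close>

abbreviation ones :: "bool list \<Rightarrow> nat" where
  "ones x \<equiv> count_list x True"

lemma finite_bit_strings_length_le: "finite {x :: bool list. length x \<le> k \<and> P x}"
  by (rule finite_subset[OF _ finite_lists_length_le[of UNIV k]]) auto

text \<open>Splitting by the first bit gives Pascal's rule.\<close>

lemma card_bit_strings_ones: "card {x. length x = k \<and> ones x = i} = k choose i"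
proof (induction k arbitrary: i)
  case 0
  have "{x. length x = 0 \<and> ones x = i} = (if i = 0 then {[]} else {})" by auto
  then show ?case by (cases i) auto
next
  case (Suc k)
  let ?A = "\<lambda>k i. {x. length x = k \<and> ones x = i}"
  have fin: "finite (?A k i)" for k i
    by (rule finite_subset[OF _ finite_bit_strings_length_le[of k "\<lambda>_. True"]]) auto
  show ?case
  proof (cases i)
    case 0
    have "?A (Suc k) i = (#) False ` ?A k 0"
      using 0 by (auto simp: length_Suc_conv split: if_splits)
    then show ?thesis using 0 Suc.IH[of 0] by (simp add: card_image)
  next
    case (Suc j)
    have "?A (Suc k) i = (#) True ` ?A k j \<union> (#) False ` ?A k i"
      using Suc by (auto simp: length_Suc_conv split: if_splits)
    moreover have "card ((#) True ` ?A k j \<union> (#) False ` ?A k i)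
        = card ((#) True ` ?A k j) + card ((#) False ` ?A k i)"
      by (rule card_Un_disjoint) (use fin in auto)
    ultimately show ?thesis using Suc Suc.IH by (simp add: card_image)
  qed
qed

text \<open>The strings of length exactly \<open>k\<close>, grouped by their number of ones, already
  account for the sum.\<close>

lemma sum_choose_le_card_bit_strings:
  "(\<Sum>i=0..m. k choose i) \<le> card {x. length x \<le> k \<and> ones x \<le> m}"
proof -
  let ?A = "\<lambda>i. {x. length x = k \<and> ones x = i}"
  have fin: "finite (?A i)" for i
    by (rule finite_subset[OF _ finite_bit_strings_length_le[of k "\<lambda>_. True"]]) auto
  have "(\<Sum>i=0..m. k choose i) = (\<Sum>i=0..m. card (?A i))"
    by (simp add: card_bit_strings_ones)
  also have "\<dots> = card (\<Union>i\<in>{0..m}. ?A i)"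
    by (rule card_UN_disjoint[symmetric]) (use fin in auto)
  also have "\<dots> \<le> card {x. length x \<le> k \<and> ones x \<le> m}"
    by (rule card_mono) (use finite_bit_strings_length_le in auto)
  finally show ?thesis .
qed

section \<open>Paths\<close>

lemma path_edges_singleton: "path_edges G [v] = []"
  by (simp add: path_edges_def)

lemma path_edges_snoc:
  "p \<noteq> [] \<Longrightarrow> path_edges G (p @ [v]) = path_edges G p @ [edge_between (directed G) (last p) v]"
proof (induction p)
  case (Cons u p)
  then show ?case by (cases p) (auto simp: path_edges_def)
qed simp

lemma path_edges_directed_cong: "directed H = directed G \<Longrightarrow> path_edges H = path_edges G"
  by (simp add: path_edges_def fun_eq_iff)

lemma length_path_edges: "length (path_edges G p) = length p - 1"
  by (simp add: path_edges_def)

lemma is_path_subgraph: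
  assumes "is_path H s p t" "directed H = directed G" "verts H \<subseteq> verts G" "edges H \<subseteq> edges G"
  shows "is_path G s p t"
  using assms path_edges_directed_cong[OF assms(2)] by (auto simp: is_path_def)

lemma is_path_remove_edges:
  "is_path (remove_edges G F) s p t \<longleftrightarrow> is_path G s p t \<and> set (path_edges G p) \<inter> F = {}"
proof -
  have "path_edges (remove_edges G F) = path_edges G"
    by (rule path_edges_directed_cong) (simp add: remove_edges_def)
  then show ?thesis by (auto simp: is_path_def remove_edges_def)
qed

section \<open>Lower bound on coverings from pairwise conflicting paths\<close>

text \<open>A spanning subgraph is determined by its edge set. Finiteness matters because
  \<open>card\<close> is 0 on infinite sets, which would spoil a lower bound.\<close>

lemma finite_spanning_subgraphs:
  fixes G :: "'a wgraph"
  assumes "finite (edges G)" "\<forall>H\<in>\<G>. spanning_subgraph H G"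
  shows "finite \<G>"
proof -
  have "H \<in> (\<lambda>E. G\<lparr>edges := E\<rparr>) ` Pow (edges G)" if "H \<in> \<G>" for H
  proof -
    have "H = G\<lparr>edges := edges H\<rparr>" and "edges H \<subseteq> edges G"
      using assms(2) that by (auto simp: spanning_subgraph_def)
    then show ?thesis by blast
  qed
  then show ?thesis using assms(1) by (meson finite_Pow_iff finite_imageI finite_subset subsetI)
qed

text \<open>Some member of the family contains \<open>P x\<close> and avoids \<open>F x\<close>. By
  \<open>cross\<close>, no subgraph can do this for two different indices, so choosing one for each
  index is injective.\<close>

lemma card_covering_ge:
  fixes G :: "'a wgraph"
  assumes cov: "replacement_path_covering L f G \<G> sub"
    and fin: "finite (edges G)"
    and F: "\<And>x. x \<in> T \<Longrightarrow> F x \<subseteq> edges G \<and> card (F x) \<le> f"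
    and path: "\<And>x. x \<in> T \<Longrightarrow> is_path G (s x) (P x) (t x) \<and> length (path_edges G (P x)) \<le> L"
    and unique: "\<And>x p. x \<in> T \<Longrightarrow> is_path G (s x) p (t x) \<Longrightarrow> p = P x"
    and avoid: "\<And>x. x \<in> T \<Longrightarrow> set (path_edges G (P x)) \<inter> F x = {}"
    and cross: "\<And>x y. x \<in> T \<Longrightarrow> y \<in> T \<Longrightarrow> x \<noteq> y \<Longrightarrow>
      set (path_edges G (P x)) \<inter> F y \<noteq> {} \<or> set (path_edges G (P y)) \<inter> F x \<noteq> {}"
  shows "card T \<le> card \<G>"
proof -
  have span: "\<forall>H\<in>\<G>. spanning_subgraph H G"
    using cov by (simp add: replacement_path_covering_def)
  have "\<exists>H\<in>\<G>. edges H \<inter> F x = {} \<and> set (path_edges G (P x)) \<subseteq> edges H" if x: "x \<in> T" for x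
  proof -
    \<comment> \<open>Every competing path in the reduced graph is a path of \<open>G\<close>, hence
      equals \<open>P x\<close>, so minimality is immediate.\<close>
    have sh: "is_shortest_path (remove_edges G (F x)) (s x) (P x) (t x)"
      unfolding is_shortest_path_def is_path_remove_edges
      using path[OF x] avoid[OF x] unique[OF x] by auto
    have "s x \<in> verts G" "t x \<in> verts G"
      using path[OF x] hd_in_set last_in_set by (fastforce simp: is_path_def)+
    with cov F[OF x] sh path[OF x] obtain H p where
      H: "H \<in> sub (F x)" "sub (F x) \<subseteq> \<G>" "edges H \<inter> F x = {}" "is_path H (s x) p (t x)"
      unfolding replacement_path_covering_def by meson
    then have HG: "spanning_subgraph H G" using span by blast
    then have "is_path G (s x) p (t x)"
      by (intro is_path_subgraph[OF H(4)]) (auto simp: spanning_subgraph_def)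
    then have "p = P x" using unique[OF x] by blast
    then have "set (path_edges G (P x)) \<subseteq> edges H"
      using H(4) HG path_edges_directed_cong[of H G]
      by (simp add: is_path_def spanning_subgraph_def)
    then show ?thesis using H by blast
  qed
  then obtain h where h: "\<And>x. x \<in> T \<Longrightarrow> h x \<in> \<G> \<and> edges (h x) \<inter> F x = {} \<and>
      set (path_edges G (P x)) \<subseteq> edges (h x)"
    by metis
  have "inj_on h T"
  proof (rule inj_onI, rule ccontr)
    fix x y assume "x \<in> T" "y \<in> T" "h x = h y" "x \<noteq> y"
    then show False using cross[of x y] h[of x] h[of y] by fastforce
  qed
  then show ?thesis
    using finite_spanning_subgraphs[OF fin span] h by (intro card_inj_on_le) auto
qed

section \<open>The binary tree\<close>

text \<open>The injective coding \<open>to_nat\<close> turns bit strings into vertices of a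
  \<open>nat wgraph\<close>.\<close>

definition tree_arc :: "bool \<Rightarrow> bool list \<Rightarrow> nat edge" where
  "tree_arc b x = Arc (to_nat x) (to_nat (b # x))"

lemma tree_arc_eq_iff [simp]: "tree_arc b x = tree_arc c y \<longleftrightarrow> b = c \<and> x = y"
  by (auto simp: tree_arc_def)

text \<open>The vertex set \<open>V\<close> is separate from \<open>T\<close> so that it can also
  hold isolated vertices.\<close>

definition tree_graph :: "bool list set \<Rightarrow> nat set \<Rightarrow> nat wgraph" where
  "tree_graph T V = \<lparr>directed = True, verts = V,
     edges = {tree_arc b x | b x. b # x \<in> T}, weight = (\<lambda>_. 1)\<rparr>"

lemma tree_graph_simps [simp]:
  "directed (tree_graph T V)" "verts (tree_graph T V) = V"
  "tree_arc b x \<in> edges (tree_graph T V) \<longleftrightarrow> b # x \<in> T"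
  by (auto simp: tree_graph_def)

lemma tree_graph_edgeD:
  "Arc u v \<in> edges (tree_graph T V) \<Longrightarrow> \<exists>b x. u = to_nat x \<and> v = to_nat (b # x) \<and> b # x \<in> T"
  by (auto simp: tree_graph_def tree_arc_def)

lemma finite_edges_tree_graph:
  assumes "finite T"
  shows "finite (edges (tree_graph T V))"
proof -
  have "edges (tree_graph T V) \<subseteq> (\<lambda>x. tree_arc (hd x) (tl x)) ` T"
    by (force simp: tree_graph_def)
  then show ?thesis using assms by (meson finite_imageI finite_subset)
qed

lemma wf_tree_graph:
  assumes "finite V" "to_nat ` T \<subseteq> V" "suffix_closed T"
  shows "wf_graph (tree_graph T V)"
  using assms by (fastforce simp: wf_graph_def tree_graph_def tree_arc_def edge_between_def
      suffix_closed_def)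

fun tree_path :: "bool list \<Rightarrow> nat list" where
  "tree_path [] = [to_nat ([] :: bool list)]"
| "tree_path (b # x) = tree_path x @ [to_nat (b # x)]"

lemma tree_path_nonempty [simp]: "tree_path x \<noteq> []"
  by (cases x) auto

lemma last_tree_path [simp]: "last (tree_path x) = to_nat x"
  by (cases x) auto

lemma length_tree_path [simp]: "length (tree_path x) = Suc (length x)"
  by (induction x) auto

lemma set_tree_path: "set (tree_path x) = {to_nat y | y. suffix y x}"
  by (induction x) (auto simp: suffix_Cons)

lemma path_edges_tree_path:
  "set (path_edges (tree_graph T V) (tree_path x)) = {tree_arc b z | b z. suffix (b # z) x}"
proof (induction x)
  case Nil
  show ?case by (simp add: path_edges_singleton)
next
  case (Cons a x)
  show ?case
    by (auto simp: path_edges_snoc Cons.IH edge_between_def suffix_Cons tree_arc_def)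
qed

lemma is_path_tree_path:
  assumes "suffix_closed T" "to_nat ` T \<subseteq> V" "x \<in> T"
  shows "is_path (tree_graph T V) (to_nat ([] :: bool list)) (tree_path x) (to_nat x)"
proof -
  have hd: "hd (tree_path x) = to_nat ([] :: bool list)"
    by (induction x) auto
  have "distinct (tree_path x)"
    by (induction x) (auto simp: set_tree_path dest: suffix_length_le)
  moreover have "set (tree_path x) \<subseteq> V"
    using assms suffix_closedD[of T _ x] by (auto simp: set_tree_path)
  ultimately show ?thesis
    using assms suffix_closedD[of T _ x] by (auto simp: is_path_def hd path_edges_tree_path)
qed

text \<open>Only one arc can enter a non-root vertex, so the path is forced backwards from its end;
  at the root, distinctness leaves only the one-vertex path.\<close>

lemma tree_graph_path_unique:
  assumes "is_path (tree_graph T V) (to_nat ([] :: bool list)) p (to_nat x)"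
  shows "p = tree_path x"
  using assms
proof (induction x arbitrary: p)
  case Nil
  then show ?case
    by (cases p) (auto simp: is_path_def split: if_splits dest: last_in_set)
next
  case (Cons b x)
  from Cons.prems obtain q where p: "p = q @ [to_nat (b # x)]"
    by (metis append_butlast_last_id is_path_def)
  have q: "q \<noteq> []" using Cons.prems by (auto simp: p is_path_def)
  have "Arc (last q) (to_nat (b # x)) \<in> edges (tree_graph T V)"
    using Cons.prems q by (auto simp: p is_path_def path_edges_snoc edge_between_def)
  then have "last q = to_nat x" by (auto dest!: tree_graph_edgeD)
  then have "is_path (tree_graph T V) (to_nat ([] :: bool list)) q (to_nat x)"
    using Cons.prems q by (auto simp: p is_path_def path_edges_snoc)
  then show ?case using Cons.IH p by simp
qed

section \<open>Failure sets\<close>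

text \<open>Membership in \<open>T\<close> is required because pruning may have removed some
  children, and failures must be edges of the graph.\<close>

definition failures :: "bool list set \<Rightarrow> bool list \<Rightarrow> nat edge set" where
  "failures T x = {tree_arc False z | z. suffix (True # z) x \<and> False # z \<in> T} \<union>
     {tree_arc b x | b. b # x \<in> T}"

lemma card_sibling_arcs:
  "finite {tree_arc False z | z. suffix (True # z) x} \<and>
   card {tree_arc False z | z. suffix (True # z) x} \<le> ones x"
proof (induction x)
  case (Cons a x)
  let ?S = "\<lambda>x. {tree_arc False z | z. suffix (True # z) x}"
  have "?S (a # x) = (if a then insert (tree_arc False x) (?S x) else ?S x)"
    by (auto simp: suffix_Cons)
  then show ?case using Cons.IH by (auto simp: card_insert_if)
qed simp

text \<open>The siblings number at most \<open>ones x\<close>. If \<open>True # x\<close> is in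
  \<open>T\<close>, then \<open>ones x + 2 \<le> f\<close> leaves room for two child arcs; otherwise
  there is at most one, and \<open>ones x + 1 \<le> f\<close>.\<close>

lemma card_failures:
  assumes "x \<in> T" "\<And>y. y \<in> T \<Longrightarrow> ones y < f"
  shows "card (failures T x) \<le> f"
proof -
  let ?A = "{tree_arc False z | z. suffix (True # z) x \<and> False # z \<in> T}"
  let ?B = "{tree_arc b x | b. b # x \<in> T}"
  have "card ?A \<le> card {tree_arc False z | z. suffix (True # z) x}"
    by (rule card_mono) (use card_sibling_arcs in auto)
  then have A: "card ?A \<le> ones x" using card_sibling_arcs[of x] by linarith
  have B: "card ?B + ones x \<le> f"
  proof (cases "True # x \<in> T")
    case True
    have "card ?B \<le> card {tree_arc False x, tree_arc True x}"
      by (rule card_mono) auto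
    then show ?thesis using assms(2)[OF True] by simp
  next
    case False
    then have "card ?B \<le> card {tree_arc False x}"
      by (intro card_mono) (auto intro: ccontr)
    then show ?thesis using assms(2)[OF assms(1)] by simp
  qed
  have "card (failures T x) \<le> card ?A + card ?B"
    unfolding failures_def by (rule card_Un_le)
  then show ?thesis using A B by linarith
qed

text \<open>The path takes only one child at each vertex, so a one-arc excludes its sibling, and it
  stops at \<open>x\<close> before any arc leaving \<open>x\<close>.\<close>

lemma tree_path_avoids_failures:
  "set (path_edges (tree_graph T V) (tree_path x)) \<inter> failures T x = {}"
  by (auto simp: path_edges_tree_path failures_def dest: suffix_Cons_unique suffix_length_le)

text \<open>If one vertex is an ancestor of the other, the path to the descendant leaves the
  ancestor by a failed arc (\<open>child\<close>). Otherwise, where the paths split, the zero-arc on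
  one is a failed sibling for the other (\<open>branch\<close>).\<close>

lemma tree_path_meets_failures:
  assumes "suffix_closed T" "x \<in> T" "y \<in> T" "x \<noteq> y"
  shows "set (path_edges (tree_graph T V) (tree_path x)) \<inter> failures T y \<noteq> {} \<or>
    set (path_edges (tree_graph T V) (tree_path y)) \<inter> failures T x \<noteq> {}"
proof -
  have child: "set (path_edges (tree_graph T V) (tree_path v)) \<inter> failures T u \<noteq> {}"
    if "suffix (b # u) v" "v \<in> T" for b u v
  proof -
    have "b # u \<in> T" using that suffix_closedD[OF assms(1)] by blast
    then have "tree_arc b u \<in> failures T u" by (auto simp: failures_def)
    moreover have "tree_arc b u \<in> set (path_edges (tree_graph T V) (tree_path v))"
      using that by (auto simp: path_edges_tree_path)
    ultimately show ?thesis by blast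
  qed
  have branch: "set (path_edges (tree_graph T V) (tree_path u)) \<inter> failures T v \<noteq> {}"
    if "suffix (False # z) u" "suffix (True # z) v" "u \<in> T" for u v z
  proof -
    have "False # z \<in> T" using that suffix_closedD[OF assms(1)] by blast
    then have "tree_arc False z \<in> failures T v" using that by (auto simp: failures_def)
    moreover have "tree_arc False z \<in> set (path_edges (tree_graph T V) (tree_path u))"
      using that by (auto simp: path_edges_tree_path)
    ultimately show ?thesis by blast
  qed
  consider b where "suffix (b # x) y" | b where "suffix (b # y) x"
    | z a b where "a \<noteq> b" "suffix (a # z) x" "suffix (b # z) y"
    using suffix_compare[of x y] assms(4) by blast
  then show ?thesis
  proof cases
    case 1
    then show ?thesis using child assms by blast
  next
    case 2
    then show ?thesis using child assms by blast
  next
    case 3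
    then show ?thesis using branch assms by (cases a) auto
  qed
qed

theorem theorem3:
  fixes n f L :: nat
  assumes "n \<ge> 1" and "f \<ge> 1" and "L \<ge> 2"
  shows "\<exists>G :: nat wgraph. wf_graph G \<and> card (verts G) = n \<and>
    (\<forall>\<G> sub. replacement_path_covering L f G \<G> sub \<longrightarrow>
       card \<G> \<ge> min (\<Sum>i=0..f-1. (L - 2) choose i) n)"
proof -
  define m where "m = min (\<Sum>i=0..f-1. (L - 2) choose i) n"
  \<comment> \<open>The root path to such a string has at most \<open>L - 2\<close> arcs, within the
    bound \<open>L\<close>; since \<open>f \<ge> 1\<close>, the second condition says
    \<open>ones x < f\<close>.\<close>
  define U where "U = {x. length x \<le> L - 2 \<and> ones x \<le> f - 1}"
  have finU: "finite U" unfolding U_def by (rule finite_bit_strings_length_le)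
  have "suffix_closed U" by (auto simp: suffix_closed_def U_def split: if_splits)
  moreover have "m \<le> card U"
    using sum_choose_le_card_bit_strings[where m = "f - 1" and k = "L - 2"]
    by (simp add: m_def U_def)
  ultimately obtain T where T: "T \<subseteq> U" "suffix_closed T" "card T = m"
    using suffix_closed_subset_card[OF finU] by blast
  have finT: "finite T" using T(1) finU finite_subset by blast
  \<comment> \<open>As \<open>m \<le> n\<close>, the coded tree fits into \<open>n\<close> vertices;
    the numbers below \<open>n\<close> supply enough candidates to fill up to exactly
    \<open>n\<close>.\<close>
  have "card (to_nat ` T) \<le> n"
    using T(3) card_image_le[OF finT, of to_nat] by (simp add: m_def)
  moreover have "n \<le> card (to_nat ` T \<union> {..<n})"
    using card_mono[of "to_nat ` T \<union> {..<n}" "{..<n}"] finT by simp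
  ultimately obtain V where V: "to_nat ` T \<subseteq> V" "V \<subseteq> to_nat ` T \<union> {..<n}" "card V = n"
    using exists_subset_between[of "to_nat ` T" n "to_nat ` T \<union> {..<n}"] finT by auto
  \<comment> \<open>A positive cardinality forces finiteness, which is where
    \<open>n \<ge> 1\<close> enters.\<close>
  have finV: "finite V" using V(3) assms(1) card_ge_0_finite by force
  let ?G = "tree_graph T V"
  have "m \<le> card \<G>" if cov: "replacement_path_covering L f ?G \<G> sub" for \<G> sub
  proof -
    have "card T \<le> card \<G>"
    proof (rule card_covering_ge[OF cov finite_edges_tree_graph[OF finT],
          where F = "failures T" and s = "\<lambda>_. to_nat ([] :: bool list)" and t = to_nat
            and P = tree_path])
      fix x assume x: "x \<in> T"
      show "failures T x \<subseteq> edges ?G \<and> card (failures T x) \<le> f"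
        using card_failures[OF x, of f] T(1) assms(2) by (force simp: failures_def U_def)
      show "is_path ?G (to_nat ([] :: bool list)) (tree_path x) (to_nat x) \<and>
          length (path_edges ?G (tree_path x)) \<le> L"
        using is_path_tree_path[OF T(2) V(1) x] x T(1) by (auto simp: length_path_edges U_def)
    qed (use tree_graph_path_unique tree_path_avoids_failures tree_path_meets_failures[OF T(2)]
      in auto)
    then show ?thesis using T(3) by simp
  qed
  then show ?thesis
    using wf_tree_graph[OF finV V(1) T(2)] V(3) unfolding m_def
    by (intro exI[of _ ?G]) auto
qed

end
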